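(* For $n\ge 1$ let $s_n$ be the number of Schroeder trees with $n$ leaves, and let $S(x)=\sum_{n\ge 1}s_nx^n$ be the ordinary generating function. Then $$S(x)=\frac{2x}{1+x+\sqrt{1-6x+x^2}}.$$
   Context: A Schroeder tree is a finite rooted plane tree (the children of each vertex are linearly ordered) in which every non-leaf vertex has at least two children. A leaf is a vertex with no children; the one-vertex tree is a Schroeder tree with one leaf. Trees are counted up to isomorphism of rooted plane trees. $\sqrt{1-6x+x^2}$ denotes the formal power series square root with constant term $1$. *)

theory Defs
  imports Complex_Main "HOL-Computational_Algebra.Formal_Power_Series"
begin

text \<open>Since the children of a vertex form a list, two isomorphic finite rooted plane trees
  are equal as elements of this datatype; counting elements is counting up to isomorphism.\<close>

datatype plane_tree = Node (children: "plane_tree list")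

fun schroeder :: "plane_tree \<Rightarrow> bool" where
  "schroeder (Node ts) \<longleftrightarrow> (ts = [] \<or> 2 \<le> length ts) \<and> (\<forall>t\<in>set ts. schroeder t)"

fun leaves :: "plane_tree \<Rightarrow> nat" where
  "leaves (Node ts) = (if ts = [] then 1 else sum_list (map leaves ts))"

definition schroeder_count :: "nat \<Rightarrow> nat" where
  "schroeder_count n = card {t. schroeder t \<and> leaves t = n}"

definition schroeder_gf :: "real fps" where
  "schroeder_gf = Abs_fps (\<lambda>n. if n \<ge> 1 then real (schroeder_count n) else 0)"

text \<open>The radicand has constant term \<open>1\<close> and \<open>root 2 1 = 1\<close>, so this is the power series
  square root with constant term \<open>1\<close>.\<close>

definition sqrt_series :: "real fps" where
  "sqrt_series = fps_radical root 2 (1 - 6 * fps_X + fps_X ^ 2)"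

lemma sqrt_series_square: "sqrt_series ^ 2 = 1 - 6 * fps_X + fps_X ^ 2"
  using power_radical[of "1 - 6 * fps_X + fps_X ^ 2 :: real fps" root 1]
  by (simp add: sqrt_series_def numeral_2_eq_2)

lemma sqrt_series_nth_0: "fps_nth sqrt_series 0 = 1"
  by (simp add: sqrt_series_def)

lemma sqrt_series_unique:
  assumes "R ^ 2 = 1 - 6 * fps_X + fps_X ^ 2" and "fps_nth R 0 = 1"
  shows "R = sqrt_series"
proof -
  have "R ^ 2 = sqrt_series ^ 2"
    using assms(1) by (simp add: sqrt_series_square)
  then have "R = sqrt_series \<or> R = - sqrt_series"
    by (simp add: power2_eq_iff)
  then show ?thesis
    using assms(2) sqrt_series_nth_0 by auto
qed

end

theory Submission
  imports Defs
begin

text \<open>Let \<open>F\<close> be the generating function of forests, that is, finite lists of Schroeder trees,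
  by total number of leaves. Splitting off the first tree gives \<open>F = 1 + S F\<close>. A forest is empty,
  a single tree, or the list of children of the root of a tree other than the one-vertex tree,
  so \<open>F = 1 + S + (S - x)\<close>. Eliminating \<open>F\<close> yields \<open>2 S\<^sup>2 - (1 + x) S + x = 0\<close>, which says that
  \<open>1 + x - 4 S\<close> is the square root of \<open>1 - 6 x + x\<^sup>2\<close> with constant term \<open>1\<close>.\<close>

definition schroeder_trees :: "nat \<Rightarrow> plane_tree set" where
  "schroeder_trees n = {t. schroeder t \<and> leaves t = n}"

definition schroeder_forests :: "nat \<Rightarrow> plane_tree list set" where
  "schroeder_forests n = {ts. (\<forall>t\<in>set ts. schroeder t) \<and> sum_list (map leaves ts) = n}"

lemma leaves_pos: "0 < leaves t"
proof (induction t)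
  case (Node ts)
  then show ?case by (cases ts) auto
qed

lemma schroeder_trees_0 [simp]: "schroeder_trees 0 = {}"
  using leaves_pos by (force simp: schroeder_trees_def)

lemma schroeder_forests_0 [simp]: "schroeder_forests 0 = {[]}"
proof -
  have "ts = []" if "sum_list (map leaves ts) = 0" for ts
    using that leaves_pos by (cases ts) (auto simp: leaves_pos[THEN gr_implies_not0])
  then show ?thesis by (auto simp: schroeder_forests_def)
qed

lemma Cons_in_schroeder_forests_iff:
  "t # ts \<in> schroeder_forests n \<longleftrightarrow>
    (\<exists>k\<le>n. t \<in> schroeder_trees k \<and> ts \<in> schroeder_forests (n - k))"
  by (auto simp: schroeder_trees_def schroeder_forests_def)

lemma schroeder_forests_eq_Cons:
  assumes "0 < n"
  shows "schroeder_forests n =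
    (\<Union>k\<le>n. case_prod (#) ` (schroeder_trees k \<times> schroeder_forests (n - k)))"
proof (intro set_eqI)
  fix us
  have "[] \<notin> schroeder_forests n"
    using assms by (simp add: schroeder_forests_def)
  then show "us \<in> schroeder_forests n \<longleftrightarrow>
    us \<in> (\<Union>k\<le>n. case_prod (#) ` (schroeder_trees k \<times> schroeder_forests (n - k)))"
    by (cases us) (auto simp: Cons_in_schroeder_forests_iff)
qed

lemma Node_in_schroeder_trees_iff:
  "Node ts \<in> schroeder_trees n \<longleftrightarrow>
    (ts = [] \<and> n = 1) \<or> (2 \<le> length ts \<and> ts \<in> schroeder_forests n)"
  by (auto simp: schroeder_trees_def schroeder_forests_def)

text \<open>Trees and forests are treated in one strong induction. The children of a root split into
  a first tree with \<open>k\<close> leaves and a nonempty rest with \<open>n - k\<close> leaves,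
  and both numbers lie strictly below \<open>n\<close>. Forests of size \<open>n\<close> may then
  use trees of size \<open>n\<close>.\<close>

lemma finite_trees_and_forests: "finite (schroeder_trees n) \<and> finite (schroeder_forests n)"
proof (induction n rule: less_induct)
  case (less n)
  have "t \<in> insert (Node []) (Node ` (\<Union>k\<in>{0<..<n}. case_prod (#) `
      (schroeder_trees k \<times> schroeder_forests (n - k))))" if t: "t \<in> schroeder_trees n" for t
  proof (cases t)
    case (Node us)
    show ?thesis
    proof (cases us)
      case Nil
      then show ?thesis using Node by simp
    next
      case (Cons u vs)
      with t Node obtain k where k: "k \<le> n" "u \<in> schroeder_trees k"
          "vs \<in> schroeder_forests (n - k)" and "vs \<noteq> []"
        by (force simp: Node_in_schroeder_trees_iff Cons_in_schroeder_forests_iff)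
      \<comment> \<open>No tree has 0 leaves, and \<open>k = n\<close> would force
        \<open>vs = []\<close>.\<close>
      then have "k \<noteq> 0" "k \<noteq> n" by (auto intro: gr0I)
      with k have "k \<in> {0<..<n}" by simp
      with k Cons have "us \<in> (\<Union>k\<in>{0<..<n}. case_prod (#) `
          (schroeder_trees k \<times> schroeder_forests (n - k)))"
        by (intro UN_I[of k]) (auto intro!: image_eqI[where x = "(u, vs)"])
      then show ?thesis unfolding Node by (intro insertI2 imageI)
    qed
  qed
  then have "schroeder_trees n \<subseteq> insert (Node []) (Node ` (\<Union>k\<in>{0<..<n}. case_prod (#) `
      (schroeder_trees k \<times> schroeder_forests (n - k))))" by blast
  then have trees: "finite (schroeder_trees n)"
    by (rule finite_subset) (use less in auto)
  have "finite (schroeder_forests n)"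
  proof (cases "n = 0")
    case False
    \<comment> \<open>The extreme cases escape the induction hypothesis: at \<open>k = 0\<close> the
      product is empty, at \<open>k = n\<close> the fact \<open>trees\<close> applies.\<close>
    have "finite (schroeder_trees k \<times> schroeder_forests (n - k))" if "k \<le> n" for k
      using that trees less False by (cases "k = 0"; cases "k = n") auto
    then show ?thesis
      using False by (simp add: schroeder_forests_eq_Cons)
  qed simp
  with trees show ?case by simp
qed

lemma finite_schroeder_trees [simp]: "finite (schroeder_trees n)"
  and finite_schroeder_forests [simp]: "finite (schroeder_forests n)"
  using finite_trees_and_forests by auto

lemma card_schroeder_forests_convolution:
  assumes "0 < n"
  shows "card (schroeder_forests n) =
    (\<Sum>k\<le>n. card (schroeder_trees k) * card (schroeder_forests (n - k)))"
proof -
  have inj: "inj_on (case_prod (#)) A" for A :: "(plane_tree \<times> plane_tree list) set"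
    by (auto simp: inj_on_def)
  have "card (schroeder_forests n) =
    (\<Sum>k\<le>n. card (case_prod (#) ` (schroeder_trees k \<times> schroeder_forests (n - k))))"
    unfolding schroeder_forests_eq_Cons[OF assms]
    \<comment> \<open>The pieces are disjoint because the head of a list determines
      \<open>k\<close>.\<close>
    by (intro card_UN_disjoint ballI impI finite_imageI finite_cartesian_product)
      (simp_all, auto simp: schroeder_trees_def)
  then show ?thesis
    by (simp add: card_image[OF inj] card_cartesian_product)
qed

text \<open>Forests with at least two trees (\<open>?C\<close>) correspond via \<open>Node\<close>
  to the trees with an internal root; the remaining forests are single trees. The correction at
  \<open>n = 1\<close> stands for the one-vertex tree, and is added on the left to avoid natural
  subtraction.\<close>

lemma card_schroeder_forests_eq_trees:
  assumes "0 < n"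
  shows "card (schroeder_forests n) + (if n = 1 then 1 else 0) = 2 * card (schroeder_trees n)"
proof -
  let ?C = "{ts \<in> schroeder_forests n. 2 \<le> length ts}"
  let ?L = "if n = 1 then {Node []} else {}"
  have "ts \<in> schroeder_forests n \<longleftrightarrow> ts \<in> ?C \<or> ts \<in> (\<lambda>t. [t]) ` schroeder_trees n" for ts
    using assms
    \<comment> \<open>The rule serves to split lists into length 0, 1 and at least 2.\<close>
    by (cases ts rule: remdups_adj.cases) (auto simp: schroeder_forests_def schroeder_trees_def)
  then have "schroeder_forests n = ?C \<union> (\<lambda>t. [t]) ` schroeder_trees n" by blast
  moreover have "card (?C \<union> (\<lambda>t. [t]) ` schroeder_trees n) = card ?C + card (schroeder_trees n)"
    by (subst card_Un_disjoint) (auto simp: card_image inj_on_def)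
  ultimately have forests: "card (schroeder_forests n) = card ?C + card (schroeder_trees n)"
    by metis
  have "t \<in> schroeder_trees n \<longleftrightarrow> t \<in> Node ` ?C \<union> ?L" for t
    by (cases t) (auto simp: Node_in_schroeder_trees_iff)
  then have "schroeder_trees n = Node ` ?C \<union> ?L" by blast
  moreover have "card (Node ` ?C \<union> ?L) = card ?C + card ?L"
    by (subst card_Un_disjoint) (auto simp: card_image inj_on_def)
  ultimately have "card (schroeder_trees n) = card ?C + card ?L"
    by metis
  with forests show ?thesis by simp
qed

definition forest_gf :: "real fps" where
  "forest_gf = Abs_fps (\<lambda>n. real (card (schroeder_forests n)))"

lemma schroeder_gf_nth: "fps_nth schroeder_gf n = real (card (schroeder_trees n))"
  by (cases "n = 0") (simp_all add: schroeder_gf_def schroeder_count_def schroeder_trees_def [symmetric])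

lemma forest_gf_eq_mult: "forest_gf = 1 + schroeder_gf * forest_gf"
proof (rule fps_ext)
  fix n
  show "fps_nth forest_gf n = fps_nth (1 + schroeder_gf * forest_gf) n"
    by (cases "n = 0")
      (simp_all add: fps_mult_nth schroeder_gf_nth forest_gf_def card_schroeder_forests_convolution
        atLeast0AtMost)
qed

lemma forest_gf_eq_trees: "forest_gf + fps_X = 1 + 2 * schroeder_gf"
proof (rule fps_ext)
  fix n
  show "fps_nth (forest_gf + fps_X) n = fps_nth (1 + 2 * schroeder_gf) n"
  proof (cases "n = 0")
    case True
    then show ?thesis
      by (simp add: forest_gf_def schroeder_gf_nth fps_mult_nth)
  next
    case False
    then have "real (card (schroeder_forests n)) + (if n = 1 then 1 else 0) =
        2 * real (card (schroeder_trees n))"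
      using arg_cong[OF card_schroeder_forests_eq_trees, of n real] by (simp split: if_splits)
    with False show ?thesis
      unfolding mult_2 fps_add_nth schroeder_gf_nth by (simp add: forest_gf_def fps_X_nth)
  qed
qed

lemma schroeder_gf_quadratic: "2 * schroeder_gf ^ 2 - (1 + fps_X) * schroeder_gf + fps_X = 0"
proof -
  have "forest_gf = 1 + 2 * schroeder_gf - fps_X"
    using forest_gf_eq_trees by (simp add: eq_diff_eq)
  with forest_gf_eq_mult have "1 + 2 * schroeder_gf - fps_X =
      1 + schroeder_gf * (1 + 2 * schroeder_gf - fps_X)"
    by metis
  then show ?thesis by algebra
qed

lemma sqrt_series_eq: "sqrt_series = 1 + fps_X - 4 * schroeder_gf"
proof (rule sqrt_series_unique[symmetric])
  show "(1 + fps_X - 4 * schroeder_gf) ^ 2 = 1 - 6 * fps_X + fps_X ^ 2"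
  proof -
    \<comment> \<open>Completing the square: the radicand is the discriminant
      \<open>(1 + x)^2 - 8 x\<close>, and the other summand is a multiple of the vanishing
      quadratic.\<close>
    have "(1 + fps_X - 4 * schroeder_gf) ^ 2 = (1 - 6 * fps_X + fps_X ^ 2) +
        8 * (2 * schroeder_gf ^ 2 - (1 + fps_X) * schroeder_gf + fps_X)"
      by (simp add: power2_eq_square algebra_simps)
    then show ?thesis by (simp only: schroeder_gf_quadratic mult_zero_right add_0_right)
  qed
  show "fps_nth (1 + fps_X - 4 * schroeder_gf) 0 = 1"
    by (simp add: schroeder_gf_nth fps_mult_nth)
qed

theorem theorem1p1:
  shows "schroeder_gf = (2 * fps_X) / (1 + fps_X + sqrt_series)"
proof -
  \<comment> \<open>The second root of the quadratic is \<open>(1 + x + sqrt_series) / 4\<close>,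
    and the product of both roots is \<open>x / 2\<close>.\<close>
  have "2 * fps_X = schroeder_gf * (1 + fps_X + sqrt_series) +
      2 * (2 * schroeder_gf ^ 2 - (1 + fps_X) * schroeder_gf + fps_X)"
    by (simp add: sqrt_series_eq power2_eq_square algebra_simps)
  then have "2 * fps_X = schroeder_gf * (1 + fps_X + sqrt_series)"
    by (simp only: schroeder_gf_quadratic mult_zero_right add_0_right)
  \<comment> \<open>This constant term is 2, so the divisor is nonzero and cancels.\<close>
  moreover have "fps_nth (1 + fps_X + sqrt_series) 0 \<noteq> 0"
    by (simp add: sqrt_series_nth_0)
  then have "1 + fps_X + sqrt_series \<noteq> 0"
    by (metis fps_zero_nth)
  ultimately show ?thesis by simp
qed

end
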